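(* Let $n,d\ge1$ be integers, let $\mathcal{T}\in\mathbb{C}^{n^{2d}}$ be a CPS tensor, and let $\pi=(\pi_1,\dots,\pi_{2d})$ be a permutation of $\{1,\dots,2d\}$ satisfying both $$\left|\{\pi_k,\pi_{d+k}\}\cap\{1,\dots,d\}\right|=1\ \ (k=1,\dots,d)\quad\text{and}\quad\left\lfloor\frac d2\right\rfloor\le\left|\{\pi_1,\dots,\pi_d\}\cap\{1,\dots,d\}\right|\le\left\lceil\frac d2\right\rceil.$$ Then the optimization problem $$\max_{\boldsymbol{x}\in\mathbb{C}^n,\ \|\boldsymbol{x}\|=1}\mathcal{T}(\overline{\boldsymbol{x}}^d\boldsymbol{x}^d)$$ is equivalent to the optimization problem $$\max\left\{\langle\overline{M_\pi(\mathcal{T})},X\rangle:\ \operatorname{tr}(X)=1,\ \operatorname{rank}(X)=1,\ X\in M_\pi(\mathrm{CPS}),\ X^{\mathrm H}=X\right\},$$ where $X$ ranges over $\mathbb{C}^{n^d\times n^d}$ and $M_\pi(\mathrm{CPS}):=\{M_\pi(\mathcal{X}):\mathcal{X}\in\mathbb{C}^{n^{2d}}\text{ is CPS}\}$. That is, the two problems have the same optimal value, and their optimal solutions correspond via $X=M_\pi(\overline{\boldsymbol{x}}^{\otimes d}\otimes\boldsymbol{x}^{\otimes d})$: if $\boldsymbol{x}$ is optimal for the first problem then this $X$ is optimal for the second, and every optimal $X$ of the second problem is of this form for some optimal $\boldsymbol{x}$ of the first.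
   Context: $\mathbb{C}^{n^{2d}}$ denotes the space of complex tensors of order $2d$ with every mode of dimension $n$. $\mathcal{T}\in\mathbb{C}^{n^{2d}}$ is partial-symmetric (PS) if its entries are invariant under any permutation of the first $d$ indices and under any permutation of the last $d$ indices. It is conjugate partial-symmetric (CPS) if it is PS and $\mathcal{T}_{i_1\dots i_d i_{d+1}\dots i_{2d}}=\overline{\mathcal{T}_{i_{d+1}\dots i_{2d}i_1\dots i_d}}$ for all indices. $\mathcal{T}(\overline{\boldsymbol{x}}^d\boldsymbol{x}^d):=\sum_{i_1,\dots,i_{2d}=1}^n\mathcal{T}_{i_1\dots i_{2d}}\overline{x_{i_1}}\cdots\overline{x_{i_d}}\,x_{i_{d+1}}\cdots x_{i_{2d}}$, which is real for CPS $\mathcal{T}$. $\|\boldsymbol{x}\|$ is the Euclidean norm. $\langle U,V\rangle:=\sum\overline{U_{ij}}V_{ij}$ is the Frobenius inner product (conjugate-linear in the first argument), the bar is entrywise conjugation and $X^{\mathrm H}$ is the conjugate transpose. $\boldsymbol{x}^{\otimes d}$ is the outer product of $d$ copies of $\boldsymbol{x}$. For $1\le i_1,\dots,i_d\le n$ put $n(i_1\dots i_d):=\sum_{k=1}^d(i_k-1)n^{d-k}+1\in\{1,\dots,n^d\}$. For a permutation $\pi$ of $\{1,\dots,2d\}$, the $\pi$-matricization $M_\pi(\mathcal{T})$ is the $n^d\times n^d$ matrix defined by $$M_\pi(\mathcal{T})_{n(i_{\pi_1}\dots i_{\pi_d})\,n(i_{\pi_{d+1}}\dots i_{\pi_{2d}})}=\mathcal{T}_{i_1\dots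 i_{2d}}\quad\text{for all }1\le i_1,\dots,i_{2d}\le n.$$ *)

theory Defs
  imports
    "Jordan_Normal_Form.DL_Rank"
    "Jordan_Normal_Form.Schur_Decomposition"
    "HOL-Analysis.L2_Norm"
    "HOL-Combinatorics.Permutations"
begin

text \<open>
  Modes of a tensor of order \<open>m\<close> are numbered \<open>1, \<dots>, m\<close>; following the convention for
  vectors and matrices, each index value runs over \<open>0, \<dots>, n - 1\<close>.
  A tensor is a function on \<open>multi_indices n m\<close>; its values elsewhere are irrelevant.
  For \<open>\<sigma> permutes {1..m}\<close> the multi-index \<open>i \<circ> \<sigma>\<close> is again in \<open>multi_indices n m\<close>.
\<close>

type_synonym tensor = "(nat \<Rightarrow> nat) \<Rightarrow> complex"

definition multi_indices :: "nat \<Rightarrow> nat \<Rightarrow> (nat \<Rightarrow> nat) set" where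
  "multi_indices n m = {1..m} \<rightarrow>\<^sub>E {..<n}"

definition partial_symmetric :: "nat \<Rightarrow> nat \<Rightarrow> tensor \<Rightarrow> bool" where
  "partial_symmetric n d T \<longleftrightarrow>
     (\<forall>i \<in> multi_indices n (2 * d). \<forall>\<sigma>.
        \<sigma> permutes {1..d} \<or> \<sigma> permutes {d + 1..2 * d} \<longrightarrow> T (i \<circ> \<sigma>) = T i)"

definition swap_halves :: "nat \<Rightarrow> (nat \<Rightarrow> nat) \<Rightarrow> (nat \<Rightarrow> nat)" where
  "swap_halves d i = (\<lambda>k \<in> {1..2 * d}. if k \<le> d then i (d + k) else i (k - d))"

definition CPS :: "nat \<Rightarrow> nat \<Rightarrow> tensor \<Rightarrow> bool" where
  "CPS n d T \<longleftrightarrow> partial_symmetric n d T \<and>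
     (\<forall>i \<in> multi_indices n (2 * d). T i = cnj (T (swap_halves d i)))"

definition tensor_form :: "nat \<Rightarrow> nat \<Rightarrow> tensor \<Rightarrow> complex vec \<Rightarrow> complex" where
  "tensor_form n d T x =
     (\<Sum>i \<in> multi_indices n (2 * d).
        T i * (\<Prod>k = 1..d. cnj (x $ i k)) * (\<Prod>k = d + 1..2 * d. x $ i k))"

definition vec_tensor_power :: "nat \<Rightarrow> complex vec \<Rightarrow> tensor" where
  "vec_tensor_power m x = (\<lambda>i. \<Prod>k = 1..m. x $ i k)"

text \<open>Outer product of a tensor of order \<open>p\<close> and a tensor of order \<open>q\<close>.\<close>

definition tensor_outer :: "nat \<Rightarrow> nat \<Rightarrow> tensor \<Rightarrow> tensor \<Rightarrow> tensor" where
  "tensor_outer p q S T = (\<lambda>i. S (restrict i {1..p}) * T (\<lambda>k \<in> {1..q}. i (p + k)))"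

text \<open>
  The lexicographic position of \<open>(j\<^sub>1, \<dots>, j\<^sub>d)\<close>, counted from \<open>0\<close>: with one-based index values
  and positions this is \<open>\<Sum>k. (j\<^sub>k - 1) n\<^bsup>d - k\<^esup> + 1\<close>.
\<close>

definition flat_index :: "nat \<Rightarrow> nat \<Rightarrow> (nat \<Rightarrow> nat) \<Rightarrow> nat" where
  "flat_index n d j = (\<Sum>k = 1..d. j k * n ^ (d - k))"

text \<open>
  The description operator picks the multi-index belonging to a matrix position;
  the lemma \<open>matricization_index\<close> below is the usual defining equation.
\<close>

definition matricization :: "nat \<Rightarrow> nat \<Rightarrow> (nat \<Rightarrow> nat) \<Rightarrow> tensor \<Rightarrow> complex mat" where
  "matricization n d \<pi> T = mat (n ^ d) (n ^ d) (\<lambda>(r, c).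
     T (THE i. i \<in> multi_indices n (2 * d) \<and>
               flat_index n d (\<lambda>k. i (\<pi> k)) = r \<and>
               flat_index n d (\<lambda>k. i (\<pi> (d + k))) = c))"

definition frobenius_inner :: "complex mat \<Rightarrow> complex mat \<Rightarrow> complex" where
  "frobenius_inner U V = (\<Sum>r < dim_row U. \<Sum>c < dim_col U. cnj (U $$ (r, c)) * V $$ (r, c))"

definition mat_trace :: "complex mat \<Rightarrow> complex" where
  "mat_trace X = (\<Sum>k < dim_row X. X $$ (k, k))"

definition unit_vectors :: "nat \<Rightarrow> complex vec set" where
  "unit_vectors n = {x \<in> carrier_vec n. L2_set (\<lambda>k. cmod (x $ k)) {..<n} = 1}"

definition feasible_matrices :: "nat \<Rightarrow> nat \<Rightarrow> (nat \<Rightarrow> nat) \<Rightarrow> complex mat set" where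
  "feasible_matrices n d \<pi> =
     {X \<in> carrier_mat (n ^ d) (n ^ d).
        mat_trace X = 1 \<and> vec_space.rank (n ^ d) X = 1 \<and>
        X \<in> matricization n d \<pi> ` {Y. CPS n d Y} \<and> mat_adjoint X = X}"

text \<open>
  Both objectives are real on the respective feasible sets, see \<open>tensor_form_real\<close> and
  \<open>frobenius_inner_real\<close>, so maximising their real parts is maximising the objectives.
\<close>

definition vec_objective :: "nat \<Rightarrow> nat \<Rightarrow> tensor \<Rightarrow> complex vec \<Rightarrow> real" where
  "vec_objective n d T x = Re (tensor_form n d T x)"

definition mat_objective :: "nat \<Rightarrow> nat \<Rightarrow> (nat \<Rightarrow> nat) \<Rightarrow> tensor \<Rightarrow> complex mat \<Rightarrow> real" where
  "mat_objective n d \<pi> T X = Re (frobenius_inner (map_mat cnj (matricization n d \<pi> T)) X)"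

definition is_max_value :: "('a \<Rightarrow> real) \<Rightarrow> 'a set \<Rightarrow> real \<Rightarrow> bool" where
  "is_max_value f S v \<longleftrightarrow> v \<in> f ` S \<and> (\<forall>y \<in> S. f y \<le> v)"

lemma flat_index_Suc: "flat_index n (Suc d) j = flat_index n d j * n + j (Suc d)"
proof -
  have "(\<Sum>k = 1..d. j k * n ^ (Suc d - k)) = (\<Sum>k = 1..d. j k * n ^ (d - k)) * n"
    unfolding sum_distrib_right by (intro sum.cong) (auto simp: Suc_diff_le)
  then show ?thesis by (simp add: flat_index_def)
qed

lemma flat_index_less:
  assumes "\<And>k. k \<in> {1..d} \<Longrightarrow> j k < n"
  shows "flat_index n d j < n ^ d"
  using assms
proof (induction d)
  case 0
  then show ?case by (simp add: flat_index_def)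
next
  case (Suc d)
  have a: "Suc (flat_index n d j) \<le> n ^ d" using Suc by force
  have b: "j (Suc d) < n" using Suc.prems by simp
  have "flat_index n (Suc d) j < Suc (flat_index n d j) * n"
    using b by (simp add: flat_index_Suc)
  also have "\<dots> \<le> n ^ d * n" using a by (rule mult_right_mono) simp
  finally show ?case by (simp add: mult.commute)
qed

lemma flat_index_inj:
  assumes "\<And>k. k \<in> {1..d} \<Longrightarrow> j k < n" "\<And>k. k \<in> {1..d} \<Longrightarrow> j' k < n"
    and "flat_index n d j = flat_index n d j'" and "k \<in> {1..d}"
  shows "j k = j' k"
  using assms
proof (induction d)
  case 0
  then show ?case by simp
next
  case (Suc d)
  have b: "j (Suc d) < n" "j' (Suc d) < n" using Suc.prems by simp_all
  have e: "flat_index n d j * n + j (Suc d) = flat_index n d j' * n + j' (Suc d)"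
    using Suc.prems(3) by (simp add: flat_index_Suc)
  have "j (Suc d) = j' (Suc d)"
    using arg_cong[OF e, of "\<lambda>t. t mod n"] b by simp
  moreover have "flat_index n d j = flat_index n d j'"
    using arg_cong[OF e, of "\<lambda>t. t div n"] b by simp
  ultimately show ?case
    using Suc by (cases "k = Suc d") auto
qed

lemma multi_indices_less:
  "i \<in> multi_indices n m \<Longrightarrow> k \<in> {1..m} \<Longrightarrow> i k < n"
  by (auto simp: multi_indices_def)

lemma matricization_position_bij:
  assumes "\<pi> permutes {1..2 * d}"
  shows "bij_betw (\<lambda>i. (flat_index n d (\<lambda>k. i (\<pi> k)), flat_index n d (\<lambda>k. i (\<pi> (d + k)))))
           (multi_indices n (2 * d)) ({..<n ^ d} \<times> {..<n ^ d})"
    (is "bij_betw ?f ?I ?P")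
proof -
  have mem: "\<pi> k \<in> {1..2 * d}" "\<pi> (d + k) \<in> {1..2 * d}" if "k \<in> {1..d}" for k
    using that permutes_in_image[OF assms] by auto
  have inj: "inj_on ?f ?I"
  proof (rule inj_onI)
    fix i i' assume i: "i \<in> ?I" and i': "i' \<in> ?I" and e: "?f i = ?f i'"
    have 1: "i (\<pi> k) = i' (\<pi> k)" if "k \<in> {1..d}" for k
      using flat_index_inj[of d "\<lambda>k. i (\<pi> k)" n "\<lambda>k. i' (\<pi> k)" k] e that mem
        multi_indices_less[OF i] multi_indices_less[OF i'] by blast
    have 2: "i (\<pi> (d + k)) = i' (\<pi> (d + k))" if "k \<in> {1..d}" for k
      using flat_index_inj[of d "\<lambda>k. i (\<pi> (d + k))" n "\<lambda>k. i' (\<pi> (d + k))" k] e that mem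
        multi_indices_less[OF i] multi_indices_less[OF i'] by blast
    have 3: "i (\<pi> k) = i' (\<pi> k)" if "k \<in> {1..2 * d}" for k
    proof (cases "k \<le> d")
      case True
      then show ?thesis using 1 that by simp
    next
      case False
      then have "k - d \<in> {1..d}" "d + (k - d) = k" using that by auto
      then show ?thesis using 2[of "k - d"] by simp
    qed
    have "i l = i' l" if "l \<in> {1..2 * d}" for l
      using 3 that permutes_image[OF assms] by (metis imageE)
    then show "i = i'"
      using i i' unfolding multi_indices_def by (metis PiE_ext)
  qed
  have sub: "?f ` ?I \<subseteq> ?P"
  proof (clarsimp, intro conjI)
    fix i assume i: "i \<in> ?I"
    show "flat_index n d (\<lambda>k. i (\<pi> k)) < n ^ d"
      by (rule flat_index_less) (use mem multi_indices_less[OF i] in blast)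
    show "flat_index n d (\<lambda>k. i (\<pi> (d + k))) < n ^ d"
      by (rule flat_index_less) (use mem multi_indices_less[OF i] in blast)
  qed
  have "card ?I = card ?P"
    by (simp add: multi_indices_def card_PiE mult_2 power_add)
  then have "card (?f ` ?I) = card ?P" using card_image[OF inj] by simp
  then have "?f ` ?I = ?P" using sub by (intro card_subset_eq) auto
  then show ?thesis using inj by (simp add: bij_betw_def)
qed

lemma matricization_index:
  assumes "\<pi> permutes {1..2 * d}" and "i \<in> multi_indices n (2 * d)"
  shows "matricization n d \<pi> T $$
           (flat_index n d (\<lambda>k. i (\<pi> k)), flat_index n d (\<lambda>k. i (\<pi> (d + k)))) = T i"
proof -
  note b = matricization_position_bij[OF assms(1), of n]
  have "(THE i'. i' \<in> multi_indices n (2 * d) \<and>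
               flat_index n d (\<lambda>k. i' (\<pi> k)) = flat_index n d (\<lambda>k. i (\<pi> k)) \<and>
               flat_index n d (\<lambda>k. i' (\<pi> (d + k))) = flat_index n d (\<lambda>k. i (\<pi> (d + k)))) = i"
    using assms(2) inj_onD[OF bij_betw_imp_inj_on[OF b]] by (intro the_equality) auto
  moreover have "flat_index n d (\<lambda>k. i (\<pi> k)) < n ^ d"
      "flat_index n d (\<lambda>k. i (\<pi> (d + k))) < n ^ d"
    using bij_betwE[OF b] assms(2) by auto
  ultimately show ?thesis by (simp add: matricization_def)
qed

lemma frobenius_inner_matricization:
  assumes "\<pi> permutes {1..2 * d}"
  shows "frobenius_inner (map_mat cnj (matricization n d \<pi> T)) (matricization n d \<pi> Y) =
    (\<Sum>i \<in> multi_indices n (2 * d). T i * Y i)"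
proof -
  have "frobenius_inner (map_mat cnj (matricization n d \<pi> T)) (matricization n d \<pi> Y) =
      (\<Sum>p \<in> {..<n ^ d} \<times> {..<n ^ d}. matricization n d \<pi> T $$ p * matricization n d \<pi> Y $$ p)"
    unfolding frobenius_inner_def sum.cartesian_product
    by (intro sum.cong) (auto simp: matricization_def)
  also have "\<dots> = (\<Sum>i \<in> multi_indices n (2 * d). T i * Y i)"
    by (subst sum.reindex_bij_betw[OF matricization_position_bij[OF assms], symmetric])
      (intro sum.cong, auto simp: matricization_index[OF assms])
  finally show ?thesis .
qed

lemma swap_halves_in:
  "i \<in> multi_indices n (2 * d) \<Longrightarrow> swap_halves d i \<in> multi_indices n (2 * d)"
  using multi_indices_less[of i n "2 * d"]
  unfolding multi_indices_def swap_halves_def restrict_PiE_iff by force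

lemma swap_halves_swap_halves:
  "i \<in> multi_indices n (2 * d) \<Longrightarrow> swap_halves d (swap_halves d i) = i"
  unfolding multi_indices_def swap_halves_def
  by (rule ext) (auto simp: restrict_def PiE_def extensional_def)

lemma sum_swap_halves:
  "(\<Sum>i \<in> multi_indices n (2 * d). g (swap_halves d i)) = (\<Sum>i \<in> multi_indices n (2 * d). g i)"
  by (rule sum.reindex_bij_witness[of _ "swap_halves d" "swap_halves d"])
    (auto simp: swap_halves_in swap_halves_swap_halves)

lemma sum_CPS_real:
  assumes "CPS n d T" and "\<And>i. i \<in> multi_indices n (2 * d) \<Longrightarrow> g i = cnj (g (swap_halves d i))"
  shows "(\<Sum>i \<in> multi_indices n (2 * d). T i * g i) \<in> \<real>"
proof -
  have "cnj (\<Sum>i \<in> multi_indices n (2 * d). T i * g i) =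
      (\<Sum>i \<in> multi_indices n (2 * d). T (swap_halves d i) * g (swap_halves d i))"
    using assms unfolding CPS_def cnj_sum complex_cnj_mult
    by (intro sum.cong refl) (metis complex_cnj_cnj)
  then show ?thesis
    by (simp add: sum_swap_halves[where g = "\<lambda>i. T i * g i"] Reals_cnj_iff)
qed

lemma tensor_form_real:
  assumes "CPS n d T"
  shows "tensor_form n d T x \<in> \<real>"
proof -
  have shift: "(\<Prod>k = d + 1..2 * d. f k) = (\<Prod>k = 1..d. f (d + k))" for f :: "nat \<Rightarrow> complex"
    by (rule prod.reindex_bij_witness[of _ "\<lambda>k. d + k" "\<lambda>k. k - d"]) auto
  show ?thesis
    unfolding tensor_form_def mult.assoc
    by (rule sum_CPS_real[OF assms])
      (simp only: shift complex_cnj_mult cnj_prod complex_cnj_cnj, simp add: swap_halves_def mult.commute)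
qed

lemma frobenius_inner_real:
  assumes "\<pi> permutes {1..2 * d}" "CPS n d T" "X \<in> matricization n d \<pi> ` {Y. CPS n d Y}"
  shows "frobenius_inner (map_mat cnj (matricization n d \<pi> T)) X \<in> \<real>"
  using assms(3) frobenius_inner_matricization[OF assms(1)] sum_CPS_real[OF assms(2)]
  unfolding CPS_def by auto

end

theory Submission
  imports Defs "HOL-Analysis.Function_Topology"
begin

text \<open>
  The map sending \<open>x\<close> to the matricization of the outer product of \<open>d\<close> copies of its conjugate
  and \<open>d\<close> copies of \<open>x\<close> preserves objectives and carries unit vectors onto feasible matrices, so both problems have the same maximum, attained by compactness.
  The point is surjectivity. A feasible matrix is a positive multiple of \<open>z z\<^sup>H\<close> with \<open>z\<close> a tensor
  of order \<open>d\<close>. If row mode \<open>k\<close> and column mode \<open>l\<close> both come from the first half of the tensor,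
  partial symmetry lets their index values be exchanged, which says that every mode-\<open>k\<close> fibre of
  \<open>z\<close> is proportional to the conjugate of every mode-\<open>l\<close> fibre. As soon as row modes of both kinds
  occur, which the balance condition guarantees for \<open>d \<ge> 2\<close>, all fibres are proportional to one
  vector or its conjugate, hence \<open>z\<close> is a product of copies of them.
\<close>

section \<open>Matrices of rank one: vanishing minors and nonzero entries\<close>

context vec_space
begin

text \<open>A nonzero 2 x 2 minor would make the columns \<open>c\<close> and \<open>c'\<close>
  linearly independent and push the rank to at least 2.\<close>

lemma rank_le_1_minor:
  assumes X: "X \<in> carrier_mat n m" and rk: "rank X \<le> 1"
    and r: "r < n" "r' < n" and c: "c < m" "c' < m"
  shows "X $$ (r, c) * X $$ (r', c') = X $$ (r, c') * X $$ (r', c)"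
proof (rule ccontr)
  assume ne: "\<not> ?thesis"
  define u v where "u = col X c" and "v = col X c'"
  have uv: "u \<in> carrier_vec n" "v \<in> carrier_vec n" using X c by (auto simp: u_def v_def)
  have e: "u $ r = X $$ (r, c)" "u $ r' = X $$ (r', c)" "v $ r = X $$ (r, c')" "v $ r' = X $$ (r', c')"
    using X c r by (auto simp: u_def v_def)
  \<comment> \<open>Distinctness as vectors matters: \<open>{u, v}\<close> is a set, and only its
    having two elements contradicts the rank bound.\<close>
  have uv_ne: "u \<noteq> v" using ne e by auto
  have "lin_indpt {u, v}"
  proof (rule finite_lin_indpt2)
    show "{u, v} \<subseteq> carrier_vec n" using uv by simp
    fix a :: "'a vec \<Rightarrow> 'a" assume l: "lincomb a {u, v} = 0\<^sub>v n"
    have 1: "a u * u $ i + a v * v $ i = 0" if "i < n" for i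
      using lincomb_index[OF that, of "{u, v}" a] uv l uv_ne that by simp
    \<comment> \<open>Cramer's rule: combining the coordinate equations at \<open>r\<close> and
      \<open>r'\<close> eliminates one coefficient and leaves the other times the
      determinant.\<close>
    have "a u * (u $ r * v $ r' - v $ r * u $ r')
        = (a u * u $ r + a v * v $ r) * v $ r' - (a u * u $ r' + a v * v $ r') * v $ r"
      by (simp add: algebra_simps)
    moreover have "a v * (u $ r * v $ r' - v $ r * u $ r')
        = (a u * u $ r' + a v * v $ r') * u $ r - (a u * u $ r + a v * v $ r) * u $ r'"
      by (simp add: algebra_simps)
    ultimately have "a u * (u $ r * v $ r' - v $ r * u $ r') = 0"
        "a v * (u $ r * v $ r' - v $ r * u $ r') = 0"
      using 1[OF r(1)] 1[OF r(2)] by auto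
    moreover have "u $ r * v $ r' - v $ r * u $ r' \<noteq> 0" using ne e by simp
    ultimately show "\<forall>w \<in> {u, v}. a w = 0" by simp
  qed simp
  moreover have "{u, v} \<subseteq> set (cols X)" using X c by (auto simp: u_def v_def cols_def)
  ultimately have "card {u, v} \<le> rank X" using rank_ge_card_indpt[OF X] by blast
  then show False using rk uv_ne by simp
qed

lemma rank_pos_entry:
  assumes X: "X \<in> carrier_mat n m" and rc: "r < n" "c < m" "X $$ (r, c) \<noteq> 0"
  shows "0 < rank X"
proof -
  have u: "col X c \<in> carrier_vec n" "col X c $ r \<noteq> 0" using X rc by auto
  have "lin_indpt {col X c}"
  proof (rule finite_lin_indpt2)
    fix a :: "'a vec \<Rightarrow> 'a" assume "lincomb a {col X c} = 0\<^sub>v n"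
    then have "a (col X c) * col X c $ r = 0"
      using lincomb_index[OF rc(1), of "{col X c}" a] u rc(1) by simp
    then show "\<forall>w \<in> {col X c}. a w = 0" using u by simp
  qed (use u in auto)
  moreover have "{col X c} \<subseteq> set (cols X)" using X rc by (auto simp: cols_def)
  ultimately have "card {col X c} \<le> rank X" using rank_ge_card_indpt[OF X] by blast
  then show ?thesis by simp
qed

end

section \<open>Hermitian matrices entrywise, flat positions and multi-indices\<close>

lemma mat_adjoint_eq_iff:
  fixes X :: "complex mat"
  assumes "X \<in> carrier_mat m m"
  shows "mat_adjoint X = X \<longleftrightarrow> (\<forall>r < m. \<forall>c < m. X $$ (r, c) = cnj (X $$ (c, r)))"
proof -
  have a: "mat_adjoint X \<in> carrier_mat m m" "\<And>r c. r < m \<Longrightarrow> c < m \<Longrightarrow> mat_adjoint X $$ (r, c) = cnj (X $$ (c, r))"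
    using assms by (auto simp: mat_adjoint_def mat_of_rows_def conjugate_complex_def)
  show ?thesis
    using a assms by (metis carrier_matD eq_matI)
qed

text \<open>Injectivity is uniqueness of base-\<open>n\<close> digits; surjectivity follows by
  counting. Sums over matrix positions thereby become sums over multi-indices.\<close>

lemma flat_index_bij: "bij_betw (flat_index n d) (multi_indices n d) {..<n ^ d}"
proof -
  have inj: "inj_on (flat_index n d) (multi_indices n d)"
  proof (rule inj_onI)
    fix i j assume i: "i \<in> multi_indices n d" and j: "j \<in> multi_indices n d"
      and e: "flat_index n d i = flat_index n d j"
    have "i k = j k" if "k \<in> {1..d}" for k
      using flat_index_inj[of d i n j k] multi_indices_less[OF i] multi_indices_less[OF j] e that by blast
    then show "i = j" using i j unfolding multi_indices_def by (metis PiE_ext)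
  qed
  have "flat_index n d ` multi_indices n d \<subseteq> {..<n ^ d}"
    using flat_index_less multi_indices_less by fastforce
  moreover have "card (flat_index n d ` multi_indices n d) = card {..<n ^ d}"
    using card_image[OF inj] by (simp add: multi_indices_def card_PiE)
  ultimately have "flat_index n d ` multi_indices n d = {..<n ^ d}"
    by (intro card_subset_eq) auto
  with inj show ?thesis by (simp add: bij_betw_def)
qed

lemma flat_index_cong:
  "(\<And>k. k \<in> {1..d} \<Longrightarrow> i k = j k) \<Longrightarrow> flat_index n d i = flat_index n d j"
  by (simp add: flat_index_def)

lemma multi_indices_upd:
  "j \<in> multi_indices n m \<Longrightarrow> k \<in> {1..m} \<Longrightarrow> p < n \<Longrightarrow> j(k := p) \<in> multi_indices n m"
  by (auto simp: multi_indices_def PiE_def extensional_def)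

lemma multi_indices_permute:
  assumes "i \<in> multi_indices n m" "\<sigma> permutes {1..m}"
  shows "i \<circ> \<sigma> \<in> multi_indices n m"
proof -
  have "\<sigma> k \<in> {1..m} \<longleftrightarrow> k \<in> {1..m}" for k by (rule permutes_in_image[OF assms(2)])
  then show ?thesis using assms(1)
    unfolding multi_indices_def PiE_def extensional_def Pi_def by (auto simp del: atLeastAtMost_iff)
qed

section \<open>The outer product of \<open>d\<close> conjugated and \<open>d\<close> plain copies of
  a vector\<close>

lemma prod_double_split:
  fixes f :: "nat \<Rightarrow> 'a :: comm_monoid_mult"
  shows "(\<Prod>k = 1..2 * d. f k) = (\<Prod>k = 1..d. f k) * (\<Prod>k = 1..d. f (d + k))"
proof -
  have "(\<Prod>k = d + 1..2 * d. f k) = (\<Prod>k = 1..d. f (d + k))"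
    by (rule prod.reindex_bij_witness[of _ "\<lambda>k. d + k" "\<lambda>k. k - d"]) auto
  moreover have "{1..2 * d} = {1..d} \<union> {d + 1..2 * d}" by auto
  ultimately show ?thesis by (simp add: prod.union_disjoint)
qed

text \<open>The factor contributed by mode \<open>m\<close> at index value \<open>t\<close>. It lets
  the outer product be written as a single product over all modes, on which permutations of modes
  act by reindexing.\<close>

definition half_factor :: "nat \<Rightarrow> (nat \<Rightarrow> complex) \<Rightarrow> nat \<Rightarrow> nat \<Rightarrow> complex" where
  "half_factor d x m t = (if m \<le> d then cnj (x t) else x t)"

abbreviation (input) rank_one_tensor :: "nat \<Rightarrow> complex vec \<Rightarrow> tensor" where
  "rank_one_tensor d x \<equiv> tensor_outer d d (vec_tensor_power d (conjugate x)) (vec_tensor_power d x)"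

lemma rank_one_tensor_eq:
  assumes x: "x \<in> carrier_vec n" and i: "i \<in> multi_indices n (2 * d)"
  shows "rank_one_tensor d x i = (\<Prod>m = 1..2 * d. half_factor d (($) x) m (i m))"
proof -
  \<comment> \<open>Entries of \<open>conjugate x\<close> are conjugates of entries of
    \<open>x\<close> only inside the dimension, hence the index bound.\<close>
  have "i k < n" if "k \<in> {1..d}" for k using that by (intro multi_indices_less[OF i]) auto
  then have "(\<Prod>k = 1..d. conjugate x $ restrict i {1..d} k) = (\<Prod>k = 1..d. half_factor d (($) x) k (i k))"
    using x by (intro prod.cong) (auto simp: half_factor_def conjugate_complex_def)
  moreover have "(\<Prod>k = 1..d. x $ (\<lambda>k \<in> {1..d}. i (d + k)) k) = (\<Prod>k = 1..d. half_factor d (($) x) (d + k) (i (d + k)))"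
    by (intro prod.cong) (auto simp: half_factor_def)
  ultimately show ?thesis
    unfolding prod_double_split tensor_outer_def vec_tensor_power_def by simp
qed

lemma rank_one_tensor_CPS:
  assumes x: "x \<in> carrier_vec n"
  shows "CPS n d (rank_one_tensor d x)"
  unfolding CPS_def partial_symmetric_def
proof (intro conjI ballI allI impI)
  let ?h = "half_factor d (($) x)"
  fix i assume i: "i \<in> multi_indices n (2 * d)"
  \<comment> \<open>Swapping halves exchanges conjugated and plain factors; the outer conjugation
    exchanges them back.\<close>
  show "rank_one_tensor d x i = cnj (rank_one_tensor d x (swap_halves d i))"
    unfolding rank_one_tensor_eq[OF x i] rank_one_tensor_eq[OF x swap_halves_in[OF i]]
      prod_double_split
    by (simp add: half_factor_def swap_halves_def mult.commute)
  fix \<sigma> assume \<sigma>: "\<sigma> permutes {1..d} \<or> \<sigma> permutes {d + 1..2 * d}"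
  then have p: "\<sigma> permutes {1..2 * d}" by (auto elim: permutes_subset)
  \<comment> \<open>A permutation of one half keeps every mode in its half, so
    \<open>half_factor\<close> does not change along \<open>\<sigma>\<close>.\<close>
  have "\<sigma> m \<le> d \<longleftrightarrow> m \<le> d" for m
    using \<sigma>
  proof
    assume "\<sigma> permutes {1..d}"
    from permutes_in_image[OF this, of m] permutes_not_in[OF this, of m]
    show ?thesis by (cases "m \<in> {1..d}") auto
  next
    assume "\<sigma> permutes {d + 1..2 * d}"
    from permutes_in_image[OF this, of m] permutes_not_in[OF this, of m]
    show ?thesis by (cases "m \<in> {d + 1..2 * d}") auto
  qed
  then have "(\<Prod>m = 1..2 * d. ?h m (i (\<sigma> m))) = (\<Prod>m = 1..2 * d. ?h (\<sigma> m) (i (\<sigma> m)))"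
    by (simp add: half_factor_def)
  also have "\<dots> = (\<Prod>m = 1..2 * d. ?h m (i m))"
    using prod.permute[OF p, of "\<lambda>m. ?h m (i m)"] by (simp add: o_def)
  finally show "rank_one_tensor d x (i \<circ> \<sigma>) = rank_one_tensor d x i"
    unfolding rank_one_tensor_eq[OF x i] rank_one_tensor_eq[OF x multi_indices_permute[OF i p]] by simp
qed

text \<open>Together with \<open>frobenius_inner_matricization\<close> this exhibits both objectives
  as the same bilinear pairing of tensors.\<close>

lemma tensor_form_eq_sum:
  assumes "x \<in> carrier_vec n"
  shows "tensor_form n d T x = (\<Sum>i \<in> multi_indices n (2 * d). T i * rank_one_tensor d x i)"
  unfolding tensor_form_def
proof (rule sum.cong[OF refl])
  fix i assume i: "i \<in> multi_indices n (2 * d)"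
  have "(\<Prod>k = d + 1..2 * d. x $ i k) = (\<Prod>k = 1..d. x $ i (d + k))"
    by (rule prod.reindex_bij_witness[of _ "\<lambda>k. d + k" "\<lambda>k. k - d"]) auto
  then show "T i * (\<Prod>k = 1..d. cnj (x $ i k)) * (\<Prod>k = d + 1..2 * d. x $ i k) = T i * rank_one_tensor d x i"
    unfolding rank_one_tensor_eq[OF assms i] prod_double_split by (simp add: half_factor_def)
qed

section \<open>Tensors whose fibres are proportional are products\<close>

lemma product_tensor_of_proportional_fibres:
  fixes z :: "(nat \<Rightarrow> nat) \<Rightarrow> complex" and w :: "nat \<Rightarrow> nat \<Rightarrow> complex"
  assumes q0: "q0 < n" "\<And>k. k \<in> {1..d} \<Longrightarrow> w k q0 \<noteq> 0"
    and fibres: "\<And>k j p q. k \<in> {1..d} \<Longrightarrow> j \<in> multi_indices n d \<Longrightarrow> p < n \<Longrightarrow> q < n \<Longrightarrow>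
      z (j(k := p)) * w k q = z (j(k := q)) * w k p"
  shows "\<exists>a. \<forall>j \<in> multi_indices n d. z j = a * (\<Prod>k = 1..d. w k (j k))"
proof -
  define z0 where "z0 = z (\<lambda>k \<in> {1..d}. q0)"
  \<comment> \<open>The first \<open>m\<close> coordinates are reset to \<open>q0\<close> one at a
    time; by \<open>fibres\<close>, resetting coordinate \<open>k\<close> costs the factor
    \<open>w k (j k) / w k q0\<close>. At \<open>m = d\<close> only the constant \<open>z0\<close>
    is left besides these factors.\<close>
  have red: "m \<le> d \<Longrightarrow> z j = (\<Prod>k = 1..m. w k (j k) / w k q0) * z (\<lambda>k. if k \<in> {1..m} then q0 else j k)"
    if j: "j \<in> multi_indices n d" for j m
  proof (induction m)
    case 0
    then show ?case by simp
  next
    case (Suc m)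
    let ?j = "\<lambda>k. if k \<in> {1..m} then q0 else j k"
    have jm: "?j \<in> multi_indices n d"
      using j q0(1) Suc.prems by (auto simp: multi_indices_def PiE_def extensional_def)
    have S: "Suc m \<in> {1..d}" using Suc.prems by simp
    have "j (Suc m) < n" using multi_indices_less[OF j S] .
    from fibres[OF S jm this q0(1)]
    have "z (?j(Suc m := j (Suc m))) * w (Suc m) q0 = z (?j(Suc m := q0)) * w (Suc m) (j (Suc m))" .
    moreover have "?j(Suc m := j (Suc m)) = ?j" by auto
    moreover have "?j(Suc m := q0) = (\<lambda>k. if k \<in> {1..Suc m} then q0 else j k)" by auto
    ultimately have "z ?j = w (Suc m) (j (Suc m)) / w (Suc m) q0 * z (\<lambda>k. if k \<in> {1..Suc m} then q0 else j k)"
      using q0(2)[OF S] by (simp add: field_simps)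
    then show ?case using Suc by simp
  qed
  show ?thesis
  proof (intro exI ballI)
    fix j assume j: "j \<in> multi_indices n d"
    have "(\<lambda>k. if k \<in> {1..d} then q0 else j k) = (\<lambda>k \<in> {1..d}. q0)"
      using j by (auto simp: multi_indices_def PiE_def extensional_def)
    with red[OF j, of d] show "z j = (z0 / (\<Prod>k = 1..d. w k q0)) * (\<Prod>k = 1..d. w k (j k))"
      by (simp add: z0_def prod_dividef)
  qed
qed

text \<open>The exchange relation compares only a mode in \<open>A\<close> with a mode outside
  \<open>A\<close>. Two modes of the same kind are compared through one of the other kind, which is
  why \<open>A\<close> has to be nonempty and proper once \<open>d\<close> exceeds 1.\<close>

lemma product_tensor_of_exchange:
  fixes z :: "(nat \<Rightarrow> nat) \<Rightarrow> complex"
  assumes A: "A \<subseteq> {1..d}" "d = 1 \<or> A \<noteq> {} \<and> A \<noteq> {1..d}"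
    and nz: "j0 \<in> multi_indices n d" "z j0 \<noteq> 0"
    and exch: "\<And>k l j j' p q. k \<in> A \<Longrightarrow> l \<in> {1..d} - A \<Longrightarrow> j \<in> multi_indices n d \<Longrightarrow>
      j' \<in> multi_indices n d \<Longrightarrow> p < n \<Longrightarrow> q < n \<Longrightarrow>
      z (j(k := p)) * cnj (z (j'(l := q))) = z (j(k := q)) * cnj (z (j'(l := p)))"
  shows "\<exists>a x. \<forall>j \<in> multi_indices n d.
    z j = a * (\<Prod>k = 1..d. if k \<in> A then cnj (x (j k)) else x (j k))"
proof (cases "d = 1")
  case True
  \<comment> \<open>For \<open>d = 1\<close> the tensor is a vector already; it is conjugated if its
    only mode lies in \<open>A\<close>.\<close>
  define x where "x t = (if 1 \<in> A then cnj (z (j0(1 := t))) else z (j0(1 := t)))" for t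
  have "z j = 1 * (\<Prod>k = 1..d. if k \<in> A then cnj (x (j k)) else x (j k))"
    if j: "j \<in> multi_indices n d" for j
  proof -
    have "j0(1 := j 1) = j"
      using j nz(1) True by (auto simp: multi_indices_def PiE_def extensional_def)
    then have "(if 1 \<in> A then cnj (x (j 1)) else x (j 1)) = z j" by (simp add: x_def)
    moreover have "(\<Prod>k = 1..d. f k) = f 1" for f :: "nat \<Rightarrow> complex"
      unfolding True by simp
    ultimately show ?thesis by (simp only: mult_1_left)
  qed
  then show ?thesis by blast
next
  case False
  with A obtain k0 l0 where k0: "k0 \<in> A" and l0: "l0 \<in> {1..d} - A" by blast
  \<comment> \<open>The reference fibres through \<open>j0\<close>: \<open>x\<close> along a mode
    outside \<open>A\<close>, \<open>y\<close> along a mode in \<open>A\<close>.\<close>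
  define x where "x t = z (j0(l0 := t))" for t
  define y where "y t = z (j0(k0 := t))" for t
  have k0': "k0 \<in> {1..d}" using k0 A by auto
  have l0': "l0 \<in> {1..d}" using l0 by auto
  define q0 where "q0 = j0 l0"
  have q0: "q0 < n" unfolding q0_def by (rule multi_indices_less[OF nz(1) l0'])
  have xq0: "x q0 \<noteq> 0" using nz by (simp add: x_def q0_def)
  have yx: "y p * cnj (x q) = y q * cnj (x p)" if "p < n" "q < n" for p q
    unfolding x_def y_def by (rule exch[OF k0 l0 nz(1) nz(1) that])
  \<comment> \<open>\<open>q0\<close> was read off mode \<open>l0\<close>, so nonvanishing of
    \<open>y\<close> there is not immediate. But \<open>y\<close> is proportional to the conjugate
    of \<open>x\<close>, so a zero at \<open>q0\<close> would spread to
    \<open>y (j0 k0) = z j0\<close>.\<close>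
  have yq0: "y q0 \<noteq> 0"
  proof
    assume "y q0 = 0"
    then have "y (j0 k0) = 0"
      using yx[OF q0 multi_indices_less[OF nz(1) k0']] xq0 by simp
    then show False using nz by (simp add: y_def)
  qed
  let ?w = "\<lambda>k t. if k \<in> A then cnj (x t) else x t"
  have "\<exists>a. \<forall>j \<in> multi_indices n d. z j = a * (\<Prod>k = 1..d. ?w k (j k))"
  proof (rule product_tensor_of_proportional_fibres[OF q0])
    show "?w k q0 \<noteq> 0" for k using xq0 by simp
    fix k j p q assume k: "k \<in> {1..d}" and j: "j \<in> multi_indices n d" and pq: "p < n" "q < n"
    show "z (j(k := p)) * ?w k q = z (j(k := q)) * ?w k p"
    proof (cases "k \<in> A")
      case True
      then show ?thesis using exch[OF True l0 j nz(1) pq] by (simp add: x_def)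
    next
      case False
      \<comment> \<open>Outside \<open>A\<close> the fibre \<open>u\<close> reaches \<open>x\<close>
        in two steps: it is proportional to the conjugate of \<open>y\<close>, and \<open>y\<close>
        to the conjugate of \<open>x\<close>. Cancelling \<open>y q0\<close> removes the
        intermediary.\<close>
      define u where "u t = z (j(k := t))" for t
      have 1: "y p * cnj (u q) = y q * cnj (u p)"
        unfolding u_def y_def using exch[OF k0 _ nz(1) j pq, of k] k False by simp
      have 2: "y t * cnj (x q0) = y q0 * cnj (x t)" if "t < n" for t using yx[OF that q0] .
      have "y q0 * (cnj (x p) * cnj (u q)) = y q0 * (cnj (x q) * cnj (u p))"
        using arg_cong[OF 1, of "\<lambda>t. t * cnj (x q0)"] 2[OF pq(1)] 2[OF pq(2)]
        by (metis (no_types, opaque_lifting) mult.assoc mult.commute)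
      then have "cnj (x p * u q) = cnj (x q * u p)" using yq0 by simp
      then have "x p * u q = x q * u p" by (simp only: complex_cnj_cancel_iff)
      then show ?thesis using False by (simp add: u_def mult.commute)
    qed
  qed
  then show ?thesis by blast
qed

section \<open>Matricization when the row and column modes at each position come from opposite
  halves\<close>

lemma sum_prod_multi_indices:
  fixes f :: "nat \<Rightarrow> 'a :: comm_semiring_1"
  shows "(\<Sum>j \<in> multi_indices n d. \<Prod>k = 1..d. f (j k)) = (\<Sum>t < n. f t) ^ d"
  unfolding multi_indices_def using prod_sum_PiE[of "{1..d}" "\<lambda>_. {..<n}" "\<lambda>_. f"] by simp

text \<open>The multi-index that the matricization puts at the position \<open>(flat_index n d r, flat_index n d c)\<close>.\<close>

definition join_index :: "(nat \<Rightarrow> nat) \<Rightarrow> nat \<Rightarrow> (nat \<Rightarrow> nat) \<Rightarrow> (nat \<Rightarrow> nat) \<Rightarrow> nat \<Rightarrow> nat" where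
  "join_index \<pi> d r c = (\<lambda>m \<in> {1..2 * d}.
     let k = inv_into UNIV \<pi> m in if k \<le> d then r k else c (k - d))"

locale mode_pairing =
  fixes n d :: nat and \<pi> :: "nat \<Rightarrow> nat"
  assumes d_pos: "1 \<le> d"
    and perm: "\<pi> permutes {1..2 * d}"
    and pairing: "k \<in> {1..d} \<Longrightarrow> \<pi> k \<le> d \<longleftrightarrow> \<not> \<pi> (d + k) \<le> d"
begin

lemma perm_in: "k \<in> {1..2 * d} \<Longrightarrow> \<pi> k \<in> {1..2 * d}"
  using permutes_in_image[OF perm] by blast

lemma join_index_perm:
  assumes "k \<in> {1..d}"
  shows "join_index \<pi> d r c (\<pi> k) = r k" "join_index \<pi> d r c (\<pi> (d + k)) = c k"
proof -
  have "\<pi> k \<in> {1..2 * d}" "\<pi> (d + k) \<in> {1..2 * d}"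
    using assms perm_in[of k] perm_in[of "d + k"] by auto
  then show "join_index \<pi> d r c (\<pi> k) = r k" "join_index \<pi> d r c (\<pi> (d + k)) = c k"
    using assms by (simp_all add: join_index_def permutes_inverses(2)[OF perm])
qed

lemma perm_cases:
  assumes "m \<in> {1..2 * d}"
  obtains k where "k \<in> {1..d}" "m = \<pi> k" | k where "k \<in> {1..d}" "m = \<pi> (d + k)"
proof -
  obtain k where k: "k \<in> {1..2 * d}" "m = \<pi> k"
    using assms permutes_image[OF perm] by blast
  show ?thesis
  proof (cases "k \<le> d")
    case True
    then show ?thesis using that(1)[of k] k by simp
  next
    case False
    then have "k - d \<in> {1..d}" "m = \<pi> (d + (k - d))" using k by auto
    then show ?thesis by (rule that(2))
  qed
qed

lemma multi_index_eqI:
  assumes "i \<in> multi_indices n (2 * d)" "i' \<in> multi_indices n (2 * d)"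
    and "\<And>k. k \<in> {1..d} \<Longrightarrow> i (\<pi> k) = i' (\<pi> k)" "\<And>k. k \<in> {1..d} \<Longrightarrow> i (\<pi> (d + k)) = i' (\<pi> (d + k))"
  shows "i = i'"
proof -
  have "i m = i' m" if "m \<in> {1..2 * d}" for m
    using that by (cases rule: perm_cases) (use assms in auto)
  then show ?thesis using assms(1,2) unfolding multi_indices_def by (metis PiE_ext)
qed

lemma join_index_in:
  assumes "r \<in> multi_indices n d" "c \<in> multi_indices n d"
  shows "join_index \<pi> d r c \<in> multi_indices n (2 * d)"
proof -
  have "join_index \<pi> d r c m < n" if "m \<in> {1..2 * d}" for m
    using that by (cases rule: perm_cases)
      (use multi_indices_less[OF assms(1)] multi_indices_less[OF assms(2)] in \<open>auto simp: join_index_perm\<close>)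
  then show ?thesis
    by (auto simp: multi_indices_def join_index_def restrict_PiE_iff)
qed

lemma matricization_join:
  assumes "r \<in> multi_indices n d" "c \<in> multi_indices n d"
  shows "matricization n d \<pi> Y $$ (flat_index n d r, flat_index n d c) = Y (join_index \<pi> d r c)"
proof -
  have "flat_index n d (\<lambda>k. join_index \<pi> d r c (\<pi> k)) = flat_index n d r"
    "flat_index n d (\<lambda>k. join_index \<pi> d r c (\<pi> (d + k))) = flat_index n d c"
    by (intro flat_index_cong; simp add: join_index_perm)+
  then show ?thesis
    using matricization_index[OF perm join_index_in[OF assms], of Y] by simp
qed

text \<open>By the pairing, \<open>\<not> \<pi> l \<le> d\<close> puts the column mode
  \<open>\<pi> (d + l)\<close> into the first half, next to the row mode \<open>\<pi> k\<close>.
  Transposing these two modes is therefore a symmetry of \<open>Y\<close>.\<close>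

lemma join_index_exchange:
  assumes Y: "partial_symmetric n d Y"
    and k: "k \<in> {1..d}" "\<pi> k \<le> d" and l: "l \<in> {1..d}" "\<not> \<pi> l \<le> d"
    and rc: "r \<in> multi_indices n d" "c \<in> multi_indices n d" and pq: "p < n" "q < n"
  shows "Y (join_index \<pi> d (r(k := p)) (c(l := q))) = Y (join_index \<pi> d (r(k := q)) (c(l := p)))"
proof -
  let ?\<tau> = "Transposition.transpose (\<pi> k) (\<pi> (d + l))"
  have l': "\<pi> (d + l) \<le> d" using pairing[OF l(1)] l(2) by simp
  have mem: "\<pi> k \<in> {1..d}" "\<pi> (d + l) \<in> {1..d}"
    using perm_in[of k] perm_in[of "d + l"] k l l' by auto
  have \<tau>: "?\<tau> permutes {1..d}" by (rule permutes_swap_id[OF mem])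
  then have \<tau>2: "?\<tau> permutes {1..2 * d}" by (rule permutes_subset) auto
  note up = multi_indices_upd[OF rc(1) k(1)] multi_indices_upd[OF rc(2) l(1)]
  have inj: "\<pi> a = \<pi> b \<longleftrightarrow> a = b" for a b using permutes_inj[OF perm] by (auto dest: injD)
  let ?i = "join_index \<pi> d (r(k := p)) (c(l := q))"
  let ?i' = "join_index \<pi> d (r(k := q)) (c(l := p))"
  have in1: "?i \<in> multi_indices n (2 * d)" and in2: "?i' \<in> multi_indices n (2 * d)"
    using up pq by (auto intro!: join_index_in)
  have "?i \<circ> ?\<tau> = ?i'"
  proof (rule multi_index_eqI[OF multi_indices_permute[OF in1 \<tau>2] in2])
    fix k' assume k': "k' \<in> {1..d}"
    \<comment> \<open>Row and column positions never coincide, so the transposition touches just row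
      position \<open>k\<close> and column position \<open>l\<close>.\<close>
    then have "d + l \<noteq> k'" "k \<noteq> d + k'" using k l by auto
    then show "(?i \<circ> ?\<tau>) (\<pi> k') = ?i' (\<pi> k')" "(?i \<circ> ?\<tau>) (\<pi> (d + k')) = ?i' (\<pi> (d + k'))"
      using k' k l
      by (auto simp: join_index_perm Transposition.transpose_def inj simp del: atLeastAtMost_iff)
  qed
  moreover have "Y (?i \<circ> ?\<tau>) = Y ?i" using Y in1 \<tau> by (auto simp: partial_symmetric_def)
  ultimately show ?thesis by simp
qed

lemma prod_join_index:
  fixes f :: "nat \<Rightarrow> nat \<Rightarrow> complex"
  shows "(\<Prod>m = 1..2 * d. f m (join_index \<pi> d r c m)) =
    (\<Prod>k = 1..d. f (\<pi> k) (r k)) * (\<Prod>k = 1..d. f (\<pi> (d + k)) (c k))"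
proof -
  have "(\<Prod>m = 1..2 * d. f m (join_index \<pi> d r c m)) = (\<Prod>m = 1..2 * d. f (\<pi> m) (join_index \<pi> d r c (\<pi> m)))"
    using prod.permute[OF perm, of "\<lambda>m. f m (join_index \<pi> d r c m)"] by (simp add: o_def)
  also have "\<dots> = (\<Prod>k = 1..d. f (\<pi> k) (r k)) * (\<Prod>k = 1..d. f (\<pi> (d + k)) (c k))"
    unfolding prod_double_split by (simp add: join_index_perm)
  finally show ?thesis .
qed

text \<open>The row part of the outer product. As a vector \<open>g\<close> over multi-indices it
  makes the matricization equal to \<open>g\<close> times its conjugate transpose.\<close>

definition half_power :: "(nat \<Rightarrow> complex) \<Rightarrow> (nat \<Rightarrow> nat) \<Rightarrow> complex" where
  "half_power x j = (\<Prod>k = 1..d. half_factor d x (\<pi> k) (j k))"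

text \<open>By the pairing, the column factor at position \<open>k\<close> is conjugated exactly
  when the row factor is not, so the column part is the conjugate of a half power.\<close>

lemma prod_half_factor_join:
  "(\<Prod>m = 1..2 * d. half_factor d x m (join_index \<pi> d r c m)) = half_power x r * cnj (half_power x c)"
proof -
  have "(\<Prod>k = 1..d. half_factor d x (\<pi> (d + k)) (c k)) = cnj (half_power x c)"
    unfolding half_power_def cnj_prod
    using pairing by (intro prod.cong) (auto simp: half_factor_def)
  then show ?thesis unfolding prod_join_index half_power_def by simp
qed

lemma matricization_rank_one_tensor:
  assumes x: "x \<in> carrier_vec n" and rc: "r \<in> multi_indices n d" "c \<in> multi_indices n d"
  shows "matricization n d \<pi> (rank_one_tensor d x) $$ (flat_index n d r, flat_index n d c) =
    half_power (($) x) r * cnj (half_power (($) x) c)"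
  unfolding matricization_join[OF rc] rank_one_tensor_eq[OF x join_index_in[OF rc]]
    prod_half_factor_join ..

lemma matricization_carrier: "matricization n d \<pi> Y \<in> carrier_mat (n ^ d) (n ^ d)"
  by (simp add: matricization_def)

text \<open>A factor times its conjugate does not depend on the half of its mode, so the sum splits
  into \<open>d\<close> equal squared norms. This computes traces.\<close>

lemma sum_half_power:
  "(\<Sum>j \<in> multi_indices n d. half_power x j * cnj (half_power x j)) = (\<Sum>t < n. x t * cnj (x t)) ^ d"
proof -
  have "half_power x j * cnj (half_power x j) = (\<Prod>k = 1..d. x (j k) * cnj (x (j k)))" for j
    unfolding half_power_def cnj_prod prod.distrib[symmetric]
    by (intro prod.cong) (auto simp: half_factor_def)
  then show ?thesis by (simp only: sum_prod_multi_indices[of "\<lambda>t. x t * cnj (x t)"])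
qed

lemma flat_obtain:
  assumes "r < n ^ d"
  obtains j where "j \<in> multi_indices n d" "r = flat_index n d j"
  using assms bij_betw_imp_surj_on[OF flat_index_bij, of n d] by (metis imageE lessThan_iff)

lemma flat_less: "j \<in> multi_indices n d \<Longrightarrow> flat_index n d j < n ^ d"
  using bij_betwE[OF flat_index_bij, of n d] by auto

lemma mat_trace_sum:
  assumes "X \<in> carrier_mat (n ^ d) (n ^ d)"
  shows "mat_trace X = (\<Sum>j \<in> multi_indices n d. X $$ (flat_index n d j, flat_index n d j))"
  using assms sum.reindex_bij_betw[OF flat_index_bij, of "\<lambda>k. X $$ (k, k)" n d]
  by (simp add: mat_trace_def)

lemma unit_vectors_iff:
  "x \<in> unit_vectors n \<longleftrightarrow> x \<in> carrier_vec n \<and> (\<Sum>t < n. x $ t * cnj (x $ t)) = 1"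
proof -
  have "(\<Sum>t < n. x $ t * cnj (x $ t)) = complex_of_real (\<Sum>t < n. (cmod (x $ t))\<^sup>2)"
    by (simp only: of_real_sum complex_norm_square)
  then show ?thesis
    by (auto simp: unit_vectors_def L2_set_def simp flip: of_real_sum of_real_power)
qed

section \<open>The feasible matrices are exactly the images of the unit vectors\<close>

lemma matricization_rank_one_feasible:
  assumes "x \<in> unit_vectors n"
  shows "matricization n d \<pi> (rank_one_tensor d x) \<in> feasible_matrices n d \<pi>"
proof -
  let ?X = "matricization n d \<pi> (rank_one_tensor d x)"
  let ?g = "half_power (($) x)"
  interpret V: vec_space "TYPE(complex)" "n ^ d" .
  have x: "x \<in> carrier_vec n" "(\<Sum>t < n. x $ t * cnj (x $ t)) = 1"
    using assms by (auto simp: unit_vectors_iff)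
  have X: "?X \<in> carrier_mat (n ^ d) (n ^ d)" by (rule matricization_carrier)
  note ent = matricization_rank_one_tensor[OF x(1)]
  have tr: "mat_trace ?X = 1"
    unfolding mat_trace_sum[OF X] using sum_half_power[of "($) x"] x(2) by (simp add: ent)
  \<comment> \<open>\<open>half_power\<close> transported from multi-indices to matrix positions,
    where the rank bound is stated.\<close>
  define w where "w r = ?g (inv_into (multi_indices n d) (flat_index n d) r)" for r
  have w: "w (flat_index n d j) = ?g j" if "j \<in> multi_indices n d" for j
    using that bij_betw_imp_inj_on[OF flat_index_bij] by (simp add: w_def)
  have Xw: "?X $$ (r, c) = w r * cnj (w c)" if "r < n ^ d" "c < n ^ d" for r c
    using flat_obtain[OF that(1)] flat_obtain[OF that(2)] by (metis ent w)
  have "V.rank ?X \<le> 1"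
    using X by (intro V.rank_le_1_product_entries[OF X, of w "\<lambda>c. cnj (w c)"]) (auto intro: Xw)
  moreover have "0 < V.rank ?X"
  proof -
    have "\<exists>r < n ^ d. ?X $$ (r, r) \<noteq> 0"
    proof (rule ccontr)
      assume "\<not> ?thesis"
      then have "mat_trace ?X = 0" using X by (simp add: mat_trace_def)
      then show False using tr by simp
    qed
    then show ?thesis using V.rank_pos_entry[OF X] by blast
  qed
  ultimately have "V.rank ?X = 1" by simp
  moreover have "mat_adjoint ?X = ?X"
    unfolding mat_adjoint_eq_iff[OF X] by (simp add: Xw)
  ultimately show ?thesis
    using X tr rank_one_tensor_CPS[OF x(1)] by (auto simp: feasible_matrices_def)
qed

lemma feasible_rank_one:
  assumes bal: "d = 1 \<or> (\<exists>k \<in> {1..d}. \<pi> k \<le> d) \<and> (\<exists>k \<in> {1..d}. \<not> \<pi> k \<le> d)"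
    and F: "X \<in> feasible_matrices n d \<pi>"
  obtains x where "x \<in> unit_vectors n" "X = matricization n d \<pi> (rank_one_tensor d x)"
proof -
  interpret V: vec_space "TYPE(complex)" "n ^ d" .
  obtain Y where Y: "CPS n d Y" "X = matricization n d \<pi> Y" using F by (auto simp: feasible_matrices_def)
  have X: "X \<in> carrier_mat (n ^ d) (n ^ d)" and tr: "mat_trace X = 1" and rk: "V.rank X = 1"
    and adj: "mat_adjoint X = X"
    using F by (auto simp: feasible_matrices_def)
  have herm: "X $$ (r, c) = cnj (X $$ (c, r))" if "r < n ^ d" "c < n ^ d" for r c
    using mat_adjoint_eq_iff[OF X] adj that by blast
  define E where "E r c = X $$ (flat_index n d r, flat_index n d c)" for r c
  \<comment> \<open>Trace 1 forces a nonzero diagonal entry; the column through it serves as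
    \<open>z\<close>.\<close>
  have "\<exists>j0 \<in> multi_indices n d. E j0 j0 \<noteq> 0"
  proof (rule ccontr)
    assume "\<not> ?thesis"
    then have "mat_trace X = 0" by (simp add: mat_trace_sum[OF X] E_def)
    then show False using tr by simp
  qed
  then obtain j0 where j0: "j0 \<in> multi_indices n d" "E j0 j0 \<noteq> 0" by blast
  define z where "z j = E j j0" for j
  \<comment> \<open>The vanishing minor on rows \<open>r\<close>, \<open>j0\<close> and columns
    \<open>c\<close>, \<open>j0\<close>, with the Hermitian property turning row \<open>j0\<close>
    into the conjugate of \<open>z\<close>.\<close>
  have Ez: "E r c = z r * cnj (z c) / E j0 j0" if "r \<in> multi_indices n d" "c \<in> multi_indices n d" for r c
  proof -
    have "E r c * E j0 j0 = E r j0 * E j0 c"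
      unfolding E_def using rk that j0 by (intro V.rank_le_1_minor[OF X]) (auto intro: flat_less)
    moreover have "E j0 c = cnj (z c)"
      unfolding E_def z_def using that j0 by (intro herm) (auto intro: flat_less)
    ultimately show ?thesis using j0 by (simp add: z_def field_simps)
  qed
  have EY: "E r c = Y (join_index \<pi> d r c)" if "r \<in> multi_indices n d" "c \<in> multi_indices n d" for r c
    unfolding E_def Y(2) using that by (rule matricization_join)
  define A where "A = {k \<in> {1..d}. \<pi> k \<le> d}"
  have "\<exists>a x. \<forall>j \<in> multi_indices n d. z j = a * (\<Prod>k = 1..d. if k \<in> A then cnj (x (j k)) else x (j k))"
  proof (rule product_tensor_of_exchange)
    show "A \<subseteq> {1..d}" "d = 1 \<or> A \<noteq> {} \<and> A \<noteq> {1..d}" using bal by (auto simp: A_def)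
    show "j0 \<in> multi_indices n d" "z j0 \<noteq> 0" using j0 by (auto simp: z_def)
    fix k l j j' p q
    assume kl: "k \<in> A" "l \<in> {1..d} - A" and j: "j \<in> multi_indices n d" "j' \<in> multi_indices n d"
      and pq: "p < n" "q < n"
    \<comment> \<open>Partial symmetry of \<open>Y\<close>, seen through the entries of
      \<open>X\<close>; cancelling \<open>E j0 j0\<close> then leaves the exchange relation for
      \<open>z\<close>.\<close>
    have "E (j(k := p)) (j'(l := q)) = E (j(k := q)) (j'(l := p))"
      using kl j pq Y(1) unfolding A_def
      by (auto simp: EY multi_indices_upd CPS_def intro!: join_index_exchange)
    then show "z (j(k := p)) * cnj (z (j'(l := q))) = z (j(k := q)) * cnj (z (j'(l := p)))"
      using kl j pq j0(2) by (auto simp: A_def Ez multi_indices_upd)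
  qed
  then obtain a v where v: "\<And>j. j \<in> multi_indices n d \<Longrightarrow>
      z j = a * (\<Prod>k = 1..d. if k \<in> A then cnj (v (j k)) else v (j k))" by blast
  have zv: "z j = a * half_power v j" if "j \<in> multi_indices n d" for j
    unfolding v[OF that] half_power_def
    by (intro arg_cong2[where f = "(*)"] prod.cong) (auto simp: half_factor_def A_def)
  define b where "b = a * cnj a / E j0 j0"
  have Eb: "E r c = b * (half_power v r * cnj (half_power v c))"
    if "r \<in> multi_indices n d" "c \<in> multi_indices n d" for r c
    using that by (simp add: Ez zv b_def)
  define N where "N = (\<Sum>t < n. (cmod (v t))\<^sup>2)"
  have Nv: "(\<Sum>t < n. v t * cnj (v t)) = complex_of_real N"
    by (simp only: N_def of_real_sum complex_norm_square)
  \<comment> \<open>The trace condition, evaluated on the product form.\<close>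
  have bN: "b * of_real N ^ d = 1"
  proof -
    have "1 = (\<Sum>j \<in> multi_indices n d. E j j)" using tr by (simp add: mat_trace_sum[OF X] E_def)
    also have "\<dots> = b * (\<Sum>j \<in> multi_indices n d. half_power v j * cnj (half_power v j))"
      by (simp add: Eb sum_distrib_left)
    finally show ?thesis by (simp add: sum_half_power Nv)
  qed
  have Npos: "0 < N"
  proof -
    \<comment> \<open>\<open>d_pos\<close> matters here: \<open>0 ^ d\<close> vanishes only for
      positive \<open>d\<close>.\<close>
    have "N \<noteq> 0" using bN d_pos by (auto simp: power_0_left)
    moreover have "0 \<le> N" unfolding N_def by (intro sum_nonneg) simp
    ultimately show ?thesis by simp
  qed
  \<comment> \<open>Normalises \<open>v\<close> to a unit vector; being real, it passes through the
    conjugated factors unchanged.\<close>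
  define s where "s = complex_of_real (1 / sqrt N)"
  have s2: "s * s = 1 / of_real N" "cnj s = s"
    using Npos by (auto simp: s_def simp flip: of_real_mult)
  define x where "x = vec n (\<lambda>t. s * v t)"
  have xc: "x \<in> carrier_vec n" by (simp add: x_def)
  have "(\<Sum>t < n. x $ t * cnj (x $ t)) = (\<Sum>t < n. (s * s) * (v t * cnj (v t)))"
    by (intro sum.cong) (auto simp: x_def s2(2))
  also have "\<dots> = 1" unfolding sum_distrib_left[symmetric] Nv s2(1) using Npos by simp
  finally have xu: "x \<in> unit_vectors n" using xc by (simp add: unit_vectors_iff)
  have hx: "half_power (($) x) j = s ^ d * half_power v j" if "j \<in> multi_indices n d" for j
  proof -
    have "half_power (($) x) j = (\<Prod>k = 1..d. s * half_factor d v (\<pi> k) (j k))"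
      unfolding half_power_def
      using multi_indices_less[OF that] by (intro prod.cong) (auto simp: half_factor_def x_def s2(2))
    then show ?thesis by (simp add: prod.distrib half_power_def)
  qed
  \<comment> \<open>The trace has fixed \<open>b\<close> as the inverse of \<open>N ^ d\<close>,
    which is exactly what rescaling both half powers produces, so no scalar is left over.\<close>
  have bs: "b = s ^ d * s ^ d"
    using bN Npos by (simp add: s2(1) field_simps flip: power_mult_distrib)
  have "X = matricization n d \<pi> (rank_one_tensor d x)"
  proof (rule eq_matI)
    fix i j assume "i < dim_row (matricization n d \<pi> (rank_one_tensor d x))"
      "j < dim_col (matricization n d \<pi> (rank_one_tensor d x))"
    then have "i < n ^ d" "j < n ^ d" by (auto simp: matricization_def)
    then obtain r c where rc: "r \<in> multi_indices n d" "c \<in> multi_indices n d"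
      and ij: "i = flat_index n d r" "j = flat_index n d c" by (metis flat_obtain)
    have "E r c = half_power (($) x) r * cnj (half_power (($) x) c)"
      using rc by (simp add: Eb hx bs s2(2))
    then show "X $$ (i, j) = matricization n d \<pi> (rank_one_tensor d x) $$ (i, j)"
      unfolding ij matricization_rank_one_tensor[OF xc rc] E_def .
  qed (use X in \<open>auto simp: matricization_def\<close>)
  with xu show thesis by (rule that)
qed

end

section \<open>Existence of a maximum by compactness\<close>

lemma vec_objective_attains_max:
  assumes "1 \<le> n"
  shows "\<exists>x \<in> unit_vectors n. \<forall>y \<in> unit_vectors n. vec_objective n d T y \<le> vec_objective n d T x"
proof -
  \<comment> \<open>Vectors are replaced by functions on \<open>nat\<close>, where the product
    topology applies: the box \<open>B\<close> is compact by Tychonoff, with coordinates from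
    \<open>n\<close> on pinned to 0, the sphere \<open>S\<close> is closed, and \<open>F\<close> is
    a polynomial in finitely many coordinates and their conjugates.\<close>
  define F :: "(nat \<Rightarrow> complex) \<Rightarrow> real" where "F f = Re (\<Sum>i \<in> multi_indices n (2 * d).
    T i * (\<Prod>k = 1..d. cnj (f (i k))) * (\<Prod>k = d + 1..2 * d. f (i k)))" for f
  define Q where "Q = {w. \<bar>Re w\<bar> \<le> 1 \<and> \<bar>Im w\<bar> \<le> 1}"
  define B :: "(nat \<Rightarrow> complex) set" where "B = (\<Pi>\<^sub>E k \<in> UNIV. if k < n then Q else {0})"
  have Q: "compact Q"
  proof -
    have "compact ((\<lambda>p. of_real (fst p) + \<i> * of_real (snd p)) ` ({-1..1 :: real} \<times> {-1..1 :: real}))"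
      by (intro compact_continuous_image continuous_intros compact_Times compact_Icc)
    also have "\<dots> = Q"
      unfolding Q_def
    proof (intro equalityI subsetI)
      fix w assume "w \<in> {w. \<bar>Re w\<bar> \<le> 1 \<and> \<bar>Im w\<bar> \<le> 1}"
      then have "(Re w, Im w) \<in> {-1..1} \<times> {-1..1}" by auto
      moreover have "w = of_real (fst (Re w, Im w)) + \<i> * of_real (snd (Re w, Im w))"
        by (simp add: complex_eq_iff)
      ultimately show "w \<in> (\<lambda>p. of_real (fst p) + \<i> * of_real (snd p)) ` ({-1..1} \<times> {-1..1})"
        by (rule rev_image_eqI)
    qed auto
    finally show ?thesis .
  qed
  define S :: "(nat \<Rightarrow> complex) set" where "S = {f. (\<Sum>k < n. (cmod (f k))\<^sup>2) = 1}"
  have "compactin (product_topology (\<lambda>k. euclidean) UNIV) B"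
    unfolding B_def compactin_PiE using Q by auto
  then have "compact B" by (simp add: euclidean_product_topology)
  moreover have "closed S"
    unfolding S_def by (intro closed_Collect_eq continuous_intros continuous_on_product_coordinates)
  ultimately have c: "compact (S \<inter> B)" by (rule closed_Int_compact[rotated])
  \<comment> \<open>The first basis vector; \<open>n \<ge> 1\<close> makes it available.\<close>
  have "(\<lambda>k. of_bool (k = 0)) \<in> S \<inter> B"
    using assms by (auto simp: S_def B_def Q_def of_bool_def if_distrib if_distribR cong: if_cong)
  then have ne: "S \<inter> B \<noteq> {}" by blast
  have "continuous_on (S \<inter> B) F"
    unfolding F_def
    by (intro continuous_intros continuous_on_subset[OF continuous_on_product_coordinates]) auto
  from continuous_attains_sup[OF c ne this]
  obtain f where f: "f \<in> S \<inter> B" "\<And>g. g \<in> S \<inter> B \<Longrightarrow> F g \<le> F f" by blast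
  have unit: "x \<in> unit_vectors n \<longleftrightarrow> x \<in> carrier_vec n \<and> (\<Sum>k < n. (cmod (x $ k))\<^sup>2) = 1" for x
    by (auto simp: unit_vectors_def L2_set_def)
  have cong: "vec_objective n d T x = F g" if "\<And>k. k < n \<Longrightarrow> x $ k = g k" for x g
  proof -
    have "x $ i k = g (i k)" if "i \<in> multi_indices n (2 * d)" "k \<in> {1..2 * d}" for i k
      using that \<open>\<And>k. k < n \<Longrightarrow> x $ k = g k\<close> multi_indices_less by blast
    then show ?thesis
      unfolding vec_objective_def tensor_form_def F_def
      by (intro arg_cong[where f = Re] sum.cong arg_cong2[where f = "(*)"] prod.cong) auto
  qed
  show ?thesis
  proof (intro bexI ballI)
    show "vec n f \<in> unit_vectors n" using f(1) by (simp add: unit S_def)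
    fix y assume y: "y \<in> unit_vectors n"
    \<comment> \<open>Padding by zeros puts the unit vector into \<open>S \<inter> B\<close>, since
      its coordinates have modulus at most 1.\<close>
    define g where "g k = (if k < n then y $ k else 0)" for k
    have sum: "(\<Sum>k < n. (cmod (y $ k))\<^sup>2) = 1" using y by (simp add: unit)
    have "cmod (y $ k) \<le> 1" if "k < n" for k
    proof -
      have "(cmod (y $ k))\<^sup>2 \<le> 1"
        using member_le_sum[of k "{..<n}" "\<lambda>k. (cmod (y $ k))\<^sup>2"] that sum by simp
      then show ?thesis by (simp add: power_le_one_iff abs_square_le_1)
    qed
    then have "g k \<in> Q" if "k < n" for k
      using that abs_Re_le_cmod[of "g k"] abs_Im_le_cmod[of "g k"]
      by (auto simp: Q_def g_def intro: order_trans)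
    then have "g \<in> S \<inter> B" using sum by (auto simp: S_def B_def g_def)
    from f(2)[OF this]
    show "vec_objective n d T y \<le> vec_objective n d T (vec n f)"
      using cong[of y g] cong[of "vec n f" f] by (simp add: g_def)
  qed
qed

section \<open>Transfer of the optimal value and of the maximisers\<close>

theorem theorem4p14:
  fixes n d :: nat and T :: tensor and \<pi> :: "nat \<Rightarrow> nat"
  assumes "n \<ge> 1" and "d \<ge> 1"
    and "CPS n d T"
    and "\<pi> permutes {1..2 * d}"
    and "\<forall>k \<in> {1..d}. card ({\<pi> k, \<pi> (d + k)} \<inter> {1..d}) = 1"
    and "\<lfloor>real d / 2\<rfloor> \<le> int (card (\<pi> ` {1..d} \<inter> {1..d}))"
    and "int (card (\<pi> ` {1..d} \<inter> {1..d})) \<le> \<lceil>real d / 2\<rceil>"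
  shows "(\<exists>v. is_max_value (vec_objective n d T) (unit_vectors n) v \<and>
              is_max_value (mat_objective n d \<pi> T) (feasible_matrices n d \<pi>) v) \<and>
         (\<forall>x. is_arg_max (vec_objective n d T) (\<lambda>x. x \<in> unit_vectors n) x \<longrightarrow>
              is_arg_max (mat_objective n d \<pi> T) (\<lambda>X. X \<in> feasible_matrices n d \<pi>)
                (matricization n d \<pi>
                  (tensor_outer d d (vec_tensor_power d (conjugate x)) (vec_tensor_power d x)))) \<and>
         (\<forall>X. is_arg_max (mat_objective n d \<pi> T) (\<lambda>X. X \<in> feasible_matrices n d \<pi>) X \<longrightarrow>
              (\<exists>x. is_arg_max (vec_objective n d T) (\<lambda>x. x \<in> unit_vectors n) x \<and>
                   X = matricization n d \<pi>
                     (tensor_outer d d (vec_tensor_power d (conjugate x)) (vec_tensor_power d x))))"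
proof -
  have mem: "\<pi> k \<in> {1..2 * d}" "\<pi> (d + k) \<in> {1..2 * d}" if "k \<in> {1..d}" for k
    using that permutes_in_image[OF assms(4)] by auto
  interpret mode_pairing n d \<pi>
  proof
    fix k assume k: "k \<in> {1..d}"
    \<comment> \<open>If both modes lay in the first half, distinctness would make the intersection
      have two elements; if neither did, it would be empty.\<close>
    have ne: "\<pi> k \<noteq> \<pi> (d + k)" using inj_eq[OF permutes_inj[OF assms(4)]] assms(2) by simp
    have card: "card ({\<pi> k, \<pi> (d + k)} \<inter> {1..d}) = 1" using assms(5) k by blast
    have p: "1 \<le> \<pi> k" "1 \<le> \<pi> (d + k)" using mem[OF k] by auto
    show "\<pi> k \<le> d \<longleftrightarrow> \<not> \<pi> (d + k) \<le> d"
    proof (cases "\<pi> k \<le> d"; cases "\<pi> (d + k) \<le> d")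
      assume "\<pi> k \<le> d" "\<pi> (d + k) \<le> d"
      then have "{\<pi> k, \<pi> (d + k)} \<inter> {1..d} = {\<pi> k, \<pi> (d + k)}" using p by auto
      then show ?thesis using card ne by simp
    next
      assume "\<not> \<pi> k \<le> d" "\<not> \<pi> (d + k) \<le> d"
      then have "{\<pi> k, \<pi> (d + k)} \<inter> {1..d} = {}" by auto
      then show ?thesis using card by simp
    qed auto
  qed (use assms in auto)
  \<comment> \<open>For \<open>d \<ge> 2\<close> the floor is at least 1 and the ceiling at most
    \<open>d - 1\<close>, so the row modes come neither all from the first half nor all from the
    second.\<close>
  have bal: "d = 1 \<or> (\<exists>k \<in> {1..d}. \<pi> k \<le> d) \<and> (\<exists>k \<in> {1..d}. \<not> \<pi> k \<le> d)"
  proof (rule disjCI, rule ccontr)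
    assume no: "\<not> ((\<exists>k \<in> {1..d}. \<pi> k \<le> d) \<and> (\<exists>k \<in> {1..d}. \<not> \<pi> k \<le> d))" and "d \<noteq> 1"
    then have "2 \<le> d" using assms(2) by simp
    then have fl: "1 \<le> \<lfloor>real d / 2\<rfloor>" and ce: "\<lceil>real d / 2\<rceil> \<le> int d - 1"
      unfolding le_floor_iff ceiling_le_iff by simp_all
    from no show False
    proof (cases "\<exists>k \<in> {1..d}. \<pi> k \<le> d")
      case True
      then have "\<pi> ` {1..d} \<inter> {1..d} = \<pi> ` {1..d}" using no mem by fastforce
      moreover have "card (\<pi> ` {1..d}) = d"
        using card_image[OF inj_on_subset[OF permutes_inj[OF assms(4)]], of "{1..d}"] by simp
      ultimately show False using assms(7) ce by simp
    next
      case False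
      then have "\<pi> ` {1..d} \<inter> {1..d} = {}" by auto
      then show False using assms(6) fl by simp
    qed
  qed
  let ?\<Phi> = "\<lambda>x. matricization n d \<pi> (rank_one_tensor d x)"
  have feas: "feasible_matrices n d \<pi> = ?\<Phi> ` unit_vectors n"
  proof (intro equalityI subsetI)
    fix X assume "X \<in> feasible_matrices n d \<pi>"
    then obtain x where "x \<in> unit_vectors n" "X = ?\<Phi> x" by (rule feasible_rank_one[OF bal])
    then show "X \<in> ?\<Phi> ` unit_vectors n" by blast
  next
    fix X assume "X \<in> ?\<Phi> ` unit_vectors n"
    then show "X \<in> feasible_matrices n d \<pi>" using matricization_rank_one_feasible by blast
  qed
  have obj: "mat_objective n d \<pi> T (?\<Phi> x) = vec_objective n d T x" if "x \<in> unit_vectors n" for x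
    using that unfolding mat_objective_def vec_objective_def frobenius_inner_matricization[OF assms(4)]
    by (simp add: tensor_form_eq_sum unit_vectors_def)
  from vec_objective_attains_max[OF assms(1), of d T]
  obtain x where x: "x \<in> unit_vectors n" "\<forall>y \<in> unit_vectors n. vec_objective n d T y \<le> vec_objective n d T x"
    by blast
  have "is_max_value (vec_objective n d T) (unit_vectors n) (vec_objective n d T x)"
    using x by (auto simp: is_max_value_def)
  moreover have "is_max_value (mat_objective n d \<pi> T) (feasible_matrices n d \<pi>) (vec_objective n d T x)"
    unfolding is_max_value_def feas
  proof
    show "vec_objective n d T x \<in> mat_objective n d \<pi> T ` ?\<Phi> ` unit_vectors n"
      unfolding image_image by (rule rev_image_eqI[OF x(1)]) (simp add: obj x(1))
    show "\<forall>X \<in> ?\<Phi> ` unit_vectors n. mat_objective n d \<pi> T X \<le> vec_objective n d T x"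
      using x(2) by (simp add: obj)
  qed
  \<comment> \<open>Vectors differing by a phase share an image under \<open>?\<Phi>\<close>;
    optimality transfers because \<open>?\<Phi>\<close> is onto the feasible set and preserves the
    objective.\<close>
  moreover have am: "is_arg_max (mat_objective n d \<pi> T) (\<lambda>X. X \<in> feasible_matrices n d \<pi>) (?\<Phi> y) \<longleftrightarrow>
      is_arg_max (vec_objective n d T) (\<lambda>x. x \<in> unit_vectors n) y" if "y \<in> unit_vectors n" for y
    using that unfolding is_arg_max_def feas by (auto simp: obj)
  moreover have "\<exists>y. is_arg_max (vec_objective n d T) (\<lambda>x. x \<in> unit_vectors n) y \<and> X = ?\<Phi> y"
    if X: "is_arg_max (mat_objective n d \<pi> T) (\<lambda>X. X \<in> feasible_matrices n d \<pi>) X" for X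
  proof -
    have "X \<in> ?\<Phi> ` unit_vectors n" using X unfolding is_arg_max_def feas by blast
    then obtain y where "y \<in> unit_vectors n" "X = ?\<Phi> y" by blast
    then show ?thesis using am X by blast
  qed
  moreover have "y \<in> unit_vectors n" if "is_arg_max (vec_objective n d T) (\<lambda>x. x \<in> unit_vectors n) y" for y
    using that unfolding is_arg_max_def by blast
  ultimately show ?thesis by blast
qed

end
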